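(* Let $G$ be a finite graph. If its automorphism group $\mathrm{Aut}(G)$ contains three non-trivial, disjoint automorphisms $\sigma_1,\sigma_2$ and $\sigma_3$, then $G$ has nonlocal symmetry.
   Context: Graphs are finite and simple. Permutations $\sigma_1,\dots,\sigma_n$ of a finite set $V$ are disjoint if $\sigma_i(a)\neq a$ implies $\sigma_j(a)=a$ for all $j\neq i$. For a graph $G$, in the $G$-automorphism game Alice and Bob receive vertices $i,j\in V(G)$ and answer with vertices $l,k\in V(G)$ respectively (without communicating); they win iff $\mathrm{rel}(i,j)=\mathrm{rel}(l,k)$, where $\mathrm{rel}$ records whether two vertices are equal, distinct and adjacent, or distinct and non-adjacent. A correlation is a function $p:V(G)^4\to[0,1]$, written $p(l,k|i,j)$, with $\sum_{l,k}p(l,k|i,j)=1$ for all $i,j$; it is winning if $p(l,k|i,j)=0$ whenever $\mathrm{rel}(i,j)\ne\mathrm{rel}(l,k)$. The winning classical correlations are the convex combinations of the correlations $p_\pi$, $\pi\in\mathrm{Aut}(G)$, where $p_\pi(l,k|i,j)=1$ if $l=\pi(i)$, $k=\pi(j)$ and $0$ otherwise. A quantum correlation is one of the form $p(l,k|i,j)=\psi^*M_{il}N_{jk}\psi$ with $\psi$ a unit vector in a Hilbert space $\mathcal H$ and $M_{il},N_{jk}\in B(\mathcal H)$ positive semidefinite, $\sum_lM_{il}=\mathbf 1=\sum_kN_{jk}$, and $M_{il}N_{jk}=N_{jk}M_{il}$ for all indices. The graph $G$ has (admits) nonlocal symmetry if there is a winning quantum correlation for the $G$-automorphism game that is not classical.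 It is known that $p$ is a winning quantum correlation for the $G$-automorphism game iff there are a unital $C^*$-algebra $\mathcal A$ with tracial state $\tau$ and a magic unitary $U=(u_{ij})_{i,j\in V(G)}$ over $\mathcal A$ ($u_{ij}=u_{ij}^*=u_{ij}^2$, $\sum_ku_{ik}=\mathbf 1=\sum_ku_{ki}$) commuting with the adjacency matrix $A_G$ such that $p(l,k|i,j)=\tau(u_{il}u_{jk})$. *)

theory Defs
  imports "HOL-Analysis.Analysis" "HOL-Algebra.Module" "Graph_Theory.Pair_Digraph"
    "HOL-Combinatorics.Permutations"
begin

section \<open>Complex Hilbert spaces and positive operators\<close>

definition complex_ring :: "complex ring" where
  "complex_ring = \<lparr>carrier = UNIV, mult = (*), one = 1, zero = 0, add = (+)\<rparr>"

text \<open>The fields \<^const>\<open>mult\<close> and \<^const>\<open>one\<close> which \<^typ>\<open>('a, 'b) module\<close> inherits from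
  rings play no role.\<close>

record 'h inner_module = "(complex, 'h) module" +
  ip :: "'h \<Rightarrow> 'h \<Rightarrow> complex"

definition ip_norm :: "('h, 'm) inner_module_scheme \<Rightarrow> 'h \<Rightarrow> real" where
  "ip_norm H x = sqrt (Re (ip H x x))"

text \<open>The inner product is linear in the second and antilinear in the first argument, so that
  \<open>ip H x y\<close> is what is written \<open>x\<^sup>* y\<close> in matrix notation.\<close>

locale complex_hilbert_space = Module.module complex_ring H
  for H :: "('h, 'm) inner_module_scheme" (structure) +
  assumes ip_cnj: "\<lbrakk>x \<in> carrier H; y \<in> carrier H\<rbrakk> \<Longrightarrow> ip H y x = cnj (ip H x y)"
    and ip_add: "\<lbrakk>x \<in> carrier H; y \<in> carrier H; z \<in> carrier H\<rbrakk>
      \<Longrightarrow> ip H x (y \<oplus>\<^bsub>H\<^esub> z) = ip H x y + ip H x z"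
    and ip_smult: "\<lbrakk>x \<in> carrier H; y \<in> carrier H\<rbrakk>
      \<Longrightarrow> ip H x (c \<odot>\<^bsub>H\<^esub> y) = c * ip H x y"
    and ip_nonneg: "x \<in> carrier H \<Longrightarrow> 0 \<le> Re (ip H x x)"
    and ip_definite: "\<lbrakk>x \<in> carrier H; ip H x x = 0\<rbrakk> \<Longrightarrow> x = \<zero>\<^bsub>H\<^esub>"
    and complete: "Metric_space.mcomplete (carrier H) (\<lambda>x y. ip_norm H (x \<ominus>\<^bsub>H\<^esub> y))"

definition bounded_operator :: "('h, 'm) inner_module_scheme \<Rightarrow> ('h \<Rightarrow> 'h) \<Rightarrow> bool" where
  "bounded_operator H T \<longleftrightarrow>
    (\<forall>x\<in>carrier H. T x \<in> carrier H) \<and>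
    (\<forall>x\<in>carrier H. \<forall>y\<in>carrier H. T (x \<oplus>\<^bsub>H\<^esub> y) = T x \<oplus>\<^bsub>H\<^esub> T y) \<and>
    (\<forall>c. \<forall>x\<in>carrier H. T (c \<odot>\<^bsub>H\<^esub> x) = c \<odot>\<^bsub>H\<^esub> T x) \<and>
    (\<exists>B. \<forall>x\<in>carrier H. ip_norm H (T x) \<le> B * ip_norm H x)"

definition positive_operator :: "('h, 'm) inner_module_scheme \<Rightarrow> ('h \<Rightarrow> 'h) \<Rightarrow> bool" where
  "positive_operator H T \<longleftrightarrow> bounded_operator H T \<and>
    (\<forall>x\<in>carrier H. ip H x (T x) \<in> \<real> \<and> 0 \<le> Re (ip H x (T x)))"


section \<open>Automorphisms\<close>

text \<open>A finite simple graph is a \<^const>\<open>pair_graph\<close>: a finite vertex set \<open>pverts G\<close> with an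
  irreflexive symmetric adjacency relation \<open>parcs G\<close>. An automorphism is extended by the identity
  outside the vertex set, so the trivial automorphism is \<^const>\<open>id\<close>.\<close>

definition graph_aut :: "'v pair_pre_digraph \<Rightarrow> ('v \<Rightarrow> 'v) set" where
  "graph_aut G = {\<pi>. \<pi> permutes pverts G \<and>
     (\<forall>u\<in>pverts G. \<forall>v\<in>pverts G. (\<pi> u, \<pi> v) \<in> parcs G \<longleftrightarrow> (u, v) \<in> parcs G)}"

definition disjoint_perms :: "'v set \<Rightarrow> ('v \<Rightarrow> 'v) list \<Rightarrow> bool" where
  "disjoint_perms V \<sigma> \<longleftrightarrow> (\<forall>i<length \<sigma>. \<forall>j<length \<sigma>. \<forall>a\<in>V.
     j \<noteq> i \<longrightarrow> (\<sigma> ! i) a \<noteq> a \<longrightarrow> (\<sigma> ! j) a = a)"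


section \<open>The automorphism game\<close>

datatype vertex_rel = Equal | Adjacent | Nonadjacent

definition rel :: "'v pair_pre_digraph \<Rightarrow> 'v \<Rightarrow> 'v \<Rightarrow> vertex_rel" where
  "rel G i j = (if i = j then Equal else if (i, j) \<in> parcs G then Adjacent else Nonadjacent)"

text \<open>\<open>p l k i j\<close> stands for \<open>p(l,k|i,j)\<close>; only its values on the vertex set are relevant.\<close>

type_synonym 'v corr = "'v \<Rightarrow> 'v \<Rightarrow> 'v \<Rightarrow> 'v \<Rightarrow> real"

definition correlation :: "'v set \<Rightarrow> 'v corr \<Rightarrow> bool" where
  "correlation V p \<longleftrightarrow>
    (\<forall>i\<in>V. \<forall>j\<in>V. \<forall>l\<in>V. \<forall>k\<in>V. p l k i j \<in> {0..1}) \<and>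
    (\<forall>i\<in>V. \<forall>j\<in>V. (\<Sum>l\<in>V. \<Sum>k\<in>V. p l k i j) = 1)"

definition winning :: "'v pair_pre_digraph \<Rightarrow> 'v corr \<Rightarrow> bool" where
  "winning G p \<longleftrightarrow> (\<forall>i\<in>pverts G. \<forall>j\<in>pverts G. \<forall>l\<in>pverts G. \<forall>k\<in>pverts G.
     rel G i j \<noteq> rel G l k \<longrightarrow> p l k i j = 0)"

definition det_corr :: "('v \<Rightarrow> 'v) \<Rightarrow> 'v corr" where
  "det_corr \<pi> l k i j = (if l = \<pi> i \<and> k = \<pi> j then 1 else 0)"

definition winning_classical :: "'v pair_pre_digraph \<Rightarrow> 'v corr \<Rightarrow> bool" where
  "winning_classical G p \<longleftrightarrow> (\<exists>w. (\<forall>\<pi>\<in>graph_aut G. 0 \<le> w \<pi>) \<and> (\<Sum>\<pi>\<in>graph_aut G. w \<pi>) = 1 \<and>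
     (\<forall>i\<in>pverts G. \<forall>j\<in>pverts G. \<forall>l\<in>pverts G. \<forall>k\<in>pverts G.
        p l k i j = (\<Sum>\<pi>\<in>graph_aut G. w \<pi> * det_corr \<pi> l k i j)))"

definition quantum_realization ::
  "('h, 'm) inner_module_scheme \<Rightarrow> 'h \<Rightarrow> ('v \<Rightarrow> 'v \<Rightarrow> 'h \<Rightarrow> 'h) \<Rightarrow> ('v \<Rightarrow> 'v \<Rightarrow> 'h \<Rightarrow> 'h)
    \<Rightarrow> 'v set \<Rightarrow> 'v corr \<Rightarrow> bool" where
  "quantum_realization H \<psi> M N V p \<longleftrightarrow>
    complex_hilbert_space H \<and> \<psi> \<in> carrier H \<and> ip_norm H \<psi> = 1 \<and>
    (\<forall>i\<in>V. \<forall>l\<in>V. positive_operator H (M i l) \<and> positive_operator H (N i l)) \<and>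
    (\<forall>i\<in>V. \<forall>x\<in>carrier H. (\<Oplus>\<^bsub>H\<^esub>l\<in>V. M i l x) = x \<and> (\<Oplus>\<^bsub>H\<^esub>k\<in>V. N i k x) = x) \<and>
    (\<forall>i\<in>V. \<forall>l\<in>V. \<forall>j\<in>V. \<forall>k\<in>V. \<forall>x\<in>carrier H. M i l (N j k x) = N j k (M i l x)) \<and>
    (\<forall>i\<in>V. \<forall>l\<in>V. \<forall>j\<in>V. \<forall>k\<in>V.
       complex_of_real (p l k i j) = ip H \<psi> (M i l (N j k \<psi>)))"

text \<open>HOL cannot quantify existentially over types, so the carrier of the Hilbert space is an
  arbitrary subset of the type \<^typ>\<open>nat \<Rightarrow> complex\<close>, with arbitrary operations. Up to isomorphism
  this covers every Hilbert space of at most continuum cardinality, in particular every separable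
  one. That is no restriction for finite \<open>V\<close>: the closed subspace generated by \<open>\<psi>\<close> under the
  finitely many operators \<open>M i l\<close>, \<open>N j k\<close> is separable, is invariant under them, and realizes the
  same correlation.\<close>

definition quantum_correlation :: "'v set \<Rightarrow> 'v corr \<Rightarrow> bool" where
  "quantum_correlation V p \<longleftrightarrow> correlation V p \<and>
    (\<exists>(H :: (nat \<Rightarrow> complex) inner_module) \<psi> M N. quantum_realization H \<psi> M N V p)"

definition nonlocal_symmetry :: "'v pair_pre_digraph \<Rightarrow> bool" where
  "nonlocal_symmetry G \<longleftrightarrow>
    (\<exists>p. quantum_correlation (pverts G) p \<and> winning G p \<and> \<not> winning_classical G p)"

end

theory Submission
  imports Defs
begin

text \<open>Applying \<open>\<sigma>\<^sub>s\<close> or the identity to the support of each \<open>\<sigma>\<^sub>s\<close> independently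
  preserves all vertex relations, because the \<open>\<sigma>\<^sub>s\<close> are disjoint. Hence a projective measurement
  with two outcomes for each \<open>s\<close>, on a tracial algebra, yields a magic unitary commuting with the
  adjacency matrix. Take three rank-one projections \<open>P\<^sub>s\<close> of two by two matrices whose Bloch vectors
  are at angles of 120 degrees: two different measurements then disagree with probability 3/4. Three
  bits never have more than two disagreeing pairs, so classical disagreement probabilities sum to at
  most 2, which is less than 9/4. The trace correlation is realized on the two by two matrices with the
  Hilbert-Schmidt product by left and right multiplication.\<close>

section \<open>Finite-dimensional Hilbert spaces\<close>

text \<open>Addition truncates, so that \<open>\<ominus>\<close> is meaningful on the whole type: the locale
  \<^locale>\<open>Metric_space\<close> requires the distance to be symmetric also outside the carrier.\<close>

definition coord_space :: "nat \<Rightarrow> (nat \<Rightarrow> complex) inner_module" where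
  "coord_space n = \<lparr>carrier = {x. \<forall>k\<ge>n. x k = 0}, mult = undefined, one = undefined,
    zero = (\<lambda>_. 0), add = (\<lambda>x y k. if k < n then x k + y k else 0),
    smult = (\<lambda>c x k. c * x k), ip = (\<lambda>x y. \<Sum>k<n. cnj (x k) * y k)\<rparr>"

lemma coord_space_simps [simp]:
  "carrier (coord_space n) = {x. \<forall>k\<ge>n. x k = 0}"
  "\<zero>\<^bsub>coord_space n\<^esub> = (\<lambda>_. 0)"
  "x \<oplus>\<^bsub>coord_space n\<^esub> y = (\<lambda>k. if k < n then x k + y k else 0)"
  "c \<odot>\<^bsub>coord_space n\<^esub> x = (\<lambda>k. c * x k)"
  "ip (coord_space n) x y = (\<Sum>k<n. cnj (x k) * y k)"
  by (simp_all add: coord_space_def)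

lemma cring_complex_ring: "cring complex_ring"
proof (intro cringI abelian_groupI comm_monoidI)
  show "\<exists>y\<in>carrier complex_ring. y \<oplus>\<^bsub>complex_ring\<^esub> x = \<zero>\<^bsub>complex_ring\<^esub>" for x
    by (auto simp: complex_ring_def intro: exI[of _ "- x"])
qed (auto simp: complex_ring_def algebra_simps)

lemma abelian_group_coord_space: "abelian_group (coord_space n)"
proof (rule abelian_groupI)
  fix x :: "nat \<Rightarrow> complex"
  assume "x \<in> carrier (coord_space n)"
  then show "\<exists>y\<in>carrier (coord_space n). y \<oplus>\<^bsub>coord_space n\<^esub> x = \<zero>\<^bsub>coord_space n\<^esub>"
    by (intro bexI[of _ "\<lambda>k. - x k"]) auto
qed (auto simp: fun_eq_iff)

text \<open>No carrier assumption is needed on \<open>y\<close>: addition discards coordinates from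
  \<open>n\<close> on, so the truncated negative of \<open>y\<close> is still the only carrier
  element whose sum with \<open>y\<close> is zero.\<close>

lemma a_minus_coord_space:
  "x \<ominus>\<^bsub>coord_space n\<^esub> y = (\<lambda>k. if k < n then x k - y k else 0)"
proof -
  have "\<ominus>\<^bsub>coord_space n\<^esub> y = (\<lambda>k. if k < n then - y k else 0)"
    unfolding a_inv_def m_inv_def
  proof (rule the_equality)
    fix z
    assume z: "z \<in> carrier (add_monoid (coord_space n)) \<and>
      y \<otimes>\<^bsub>add_monoid (coord_space n)\<^esub> z = \<one>\<^bsub>add_monoid (coord_space n)\<^esub> \<and>
      z \<otimes>\<^bsub>add_monoid (coord_space n)\<^esub> y = \<one>\<^bsub>add_monoid (coord_space n)\<^esub>"
    then have "z k = (if k < n then - y k else 0)" for k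
      by (cases "k < n") (auto simp: fun_eq_iff add_eq_0_iff dest: spec[of _ k])
    then show "z = (\<lambda>k. if k < n then - y k else 0)"
      by blast
  qed (auto simp: fun_eq_iff)
  then show ?thesis
    by (auto simp: a_minus_def)
qed

lemma ip_norm_coord_space: "ip_norm (coord_space n) x = L2_set (\<lambda>k. cmod (x k)) {..<n}"
  by (simp add: ip_norm_def L2_set_def cmod_power2 flip: power2_eq_square)

lemma finsum_coord_space:
  assumes "finite V" "\<And>l. l \<in> V \<Longrightarrow> f l \<in> carrier (coord_space n)"
  shows "(\<Oplus>\<^bsub>coord_space n\<^esub>l\<in>V. f l) = (\<lambda>k. \<Sum>l\<in>V. f l k)"
  using assms
proof (induction V)
  case empty
  then show ?case
    using abelian_monoid.finsum_empty[OF abelian_group.axioms(1)[OF abelian_group_coord_space]]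
    by simp
next
  case (insert l V)
  then have "(\<Oplus>\<^bsub>coord_space n\<^esub>l\<in>insert l V. f l)
      = f l \<oplus>\<^bsub>coord_space n\<^esub> (\<Oplus>\<^bsub>coord_space n\<^esub>l\<in>V. f l)"
    by (intro abelian_monoid.finsum_insert[OF abelian_group.axioms(1)[OF abelian_group_coord_space]])
      (auto simp: Pi_def)
  also have "(\<Oplus>\<^bsub>coord_space n\<^esub>l\<in>V. f l) = (\<lambda>k. \<Sum>l\<in>V. f l k)"
    using insert by blast
  finally show ?case
    using insert by (auto simp: fun_eq_iff)
qed

section \<open>Completeness of the coordinate spaces\<close>

lemma coord_space_dist:
  "ip_norm (coord_space n) (x \<ominus>\<^bsub>coord_space n\<^esub> y) = L2_set (\<lambda>k. cmod (x k - y k)) {..<n}"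
  unfolding ip_norm_coord_space a_minus_coord_space by (rule L2_set_cong) auto

lemma Metric_space_coord_space:
  "Metric_space (carrier (coord_space n))
     (\<lambda>x y. ip_norm (coord_space n) (x \<ominus>\<^bsub>coord_space n\<^esub> y))"
  unfolding coord_space_dist
proof
  fix x y z :: "nat \<Rightarrow> complex"
  show "0 \<le> L2_set (\<lambda>k. cmod (x k - y k)) {..<n}"
    by simp
  show "L2_set (\<lambda>k. cmod (x k - y k)) {..<n} = L2_set (\<lambda>k. cmod (y k - x k)) {..<n}"
    by (simp add: norm_minus_commute)
  show "L2_set (\<lambda>k. cmod (x k - y k)) {..<n} = 0 \<longleftrightarrow> x = y"
    if "x \<in> carrier (coord_space n)" "y \<in> carrier (coord_space n)"
    using that by (simp add: L2_set_eq_0_iff fun_eq_iff) (metis lessThan_iff linorder_not_le)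
  have "L2_set (\<lambda>k. cmod (x k - z k)) {..<n}
      \<le> L2_set (\<lambda>k. cmod (x k - y k) + cmod (y k - z k)) {..<n}"
    by (rule L2_set_mono) (auto intro: norm_diff_triangle_ineq order_trans[OF _ norm_triangle_ineq])
  also have "\<dots> \<le> L2_set (\<lambda>k. cmod (x k - y k)) {..<n} + L2_set (\<lambda>k. cmod (y k - z k)) {..<n}"
    by (rule L2_set_triangle_ineq)
  finally show "L2_set (\<lambda>k. cmod (x k - z k)) {..<n}
      \<le> L2_set (\<lambda>k. cmod (x k - y k)) {..<n} + L2_set (\<lambda>k. cmod (y k - z k)) {..<n}" .
qed

lemma mcomplete_coord_space:
  "Metric_space.mcomplete (carrier (coord_space n))
     (\<lambda>x y. ip_norm (coord_space n) (x \<ominus>\<^bsub>coord_space n\<^esub> y))"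
proof -
  interpret Metric_space "carrier (coord_space n)"
    "\<lambda>x y. ip_norm (coord_space n) (x \<ominus>\<^bsub>coord_space n\<^esub> y)"
    by (rule Metric_space_coord_space)
  show ?thesis
    unfolding mcomplete_def
  proof (intro allI impI)
    fix x :: "nat \<Rightarrow> nat \<Rightarrow> complex"
    assume x: "MCauchy x"
    have carr: "x m \<in> carrier (coord_space n)" for m
      using x unfolding MCauchy_def by blast
    have "Cauchy (\<lambda>m. x m k)" for k
    proof (cases "k < n")
      case True
      show ?thesis
      proof (rule metric_CauchyI)
        fix e :: real
        assume "0 < e"
        then obtain N where N: "\<And>m m'. N \<le> m \<Longrightarrow> N \<le> m' \<Longrightarrow>
            L2_set (\<lambda>k. cmod (x m k - x m' k)) {..<n} < e"
          using x[unfolded MCauchy_def] unfolding coord_space_dist by blast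
        have "cmod (x m k - x m' k) \<le> L2_set (\<lambda>k. cmod (x m k - x m' k)) {..<n}" for m m'
          using True by (intro member_le_L2_set) auto
        then show "\<exists>N. \<forall>m\<ge>N. \<forall>m'\<ge>N. dist (x m k) (x m' k) < e"
          unfolding dist_norm using N by (intro exI[of _ N] allI impI) (rule order_le_less_trans)
      qed
    next
      case False
      then have "(\<lambda>m. x m k) = (\<lambda>m. 0)"
        using carr by auto
      then show ?thesis
        by (simp add: Cauchy_def)
    qed
    then have y: "(\<lambda>m. x m k) \<longlonglongrightarrow> lim (\<lambda>m. x m k)" for k
      by (simp add: Cauchy_convergent_iff convergent_LIMSEQ_iff)
    define y where "y k = lim (\<lambda>m. x m k)" for k
    note y = y[folded y_def]
    have "y k = 0" if "n \<le> k" for k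
      using carr that y[of k] by (simp add: LIMSEQ_const_iff)
    \<comment> \<open>The distance to the coordinatewise limit is at most the sum of the
      \<open>n\<close> coordinate distances, each of which tends to 0.\<close>
    moreover have "(\<lambda>m. L2_set (\<lambda>k. cmod (x m k - y k)) {..<n}) \<longlonglongrightarrow> 0"
    proof (rule tendsto_sandwich[OF _ _ tendsto_const])
      show "(\<lambda>m. \<Sum>k<n. cmod (x m k - y k)) \<longlonglongrightarrow> 0"
        using y by (intro tendsto_null_sum tendsto_norm_zero LIM_zero)
    qed (auto intro!: always_eventually L2_set_le_sum)
    ultimately have "limitin mtopology x y sequentially"
      using carr by (subst limitin_metric_dist_null) (auto simp: coord_space_dist)
    then show "\<exists>y. limitin mtopology x y sequentially"
      by blast
  qed
qed

lemma module_coord_space: "module complex_ring (coord_space n)"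
  by (rule moduleI[OF cring_complex_ring abelian_group_coord_space])
    (simp_all add: complex_ring_def fun_eq_iff algebra_simps)

lemma complex_hilbert_space_coord_space: "complex_hilbert_space (coord_space n)"
proof (intro complex_hilbert_space.intro complex_hilbert_space_axioms.intro
    module_coord_space mcomplete_coord_space)
  fix x :: "nat \<Rightarrow> complex"
  assume x: "x \<in> carrier (coord_space n)" "ip (coord_space n) x x = 0"
  have "(\<Sum>k<n. (cmod (x k))\<^sup>2) = Re (ip (coord_space n) x x)"
    by (simp add: cmod_power2 flip: power2_eq_square)
  also have "\<dots> = 0"
    by (simp only: x(2) zero_complex.sel)
  finally have "x k = 0" if "k < n" for k
    using that by (simp add: sum_nonneg_eq_0_iff)
  then show "x = \<zero>\<^bsub>coord_space n\<^esub>"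
    using x by (auto simp: fun_eq_iff) (metis linorder_not_le)
next
  show "0 \<le> Re (ip (coord_space n) x x)" for x
    by (simp add: sum_nonneg)
  show "ip (coord_space n) y x = cnj (ip (coord_space n) x y)" for x y
    by (simp add: mult.commute)
  show "ip (coord_space n) x (y \<oplus>\<^bsub>coord_space n\<^esub> z) = ip (coord_space n) x y + ip (coord_space n) x z"
    for x y z
    by (simp add: distrib_left sum.distrib)
  show "ip (coord_space n) x (c \<odot>\<^bsub>coord_space n\<^esub> y) = c * ip (coord_space n) x y" for c x y
    by (simp add: sum_distrib_left mult.left_commute)
qed


section \<open>Operators given by real matrices\<close>

definition mat_op :: "nat \<Rightarrow> (nat \<Rightarrow> nat \<Rightarrow> real) \<Rightarrow> (nat \<Rightarrow> complex) \<Rightarrow> nat \<Rightarrow> complex" where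
  "mat_op n A x m = (if m < n then \<Sum>k<n. A m k * x k else 0)"

lemma mat_op_carrier: "mat_op n A x \<in> carrier (coord_space n)"
  by (simp add: mat_op_def)

text \<open>The sum of the moduli of the entries is a crude operator bound, because each coordinate
  of \<open>x\<close> is at most its norm.\<close>

lemma bounded_operator_mat_op: "bounded_operator (coord_space n) (mat_op n A)"
proof -
  have "ip_norm (coord_space n) (mat_op n A x)
      \<le> (\<Sum>m<n. \<Sum>k<n. \<bar>A m k\<bar>) * ip_norm (coord_space n) x" for x
  proof -
    have "ip_norm (coord_space n) (mat_op n A x) \<le> (\<Sum>m<n. cmod (mat_op n A x m))"
      unfolding ip_norm_coord_space by (rule L2_set_le_sum) simp
    also have "\<dots> \<le> (\<Sum>m<n. \<Sum>k<n. \<bar>A m k\<bar> * ip_norm (coord_space n) x)"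
    proof (rule sum_mono)
      fix m
      assume "m \<in> {..<n}"
      then have "cmod (mat_op n A x m) \<le> (\<Sum>k<n. \<bar>A m k\<bar> * cmod (x k))"
        using norm_sum[of "\<lambda>k. A m k * x k" "{..<n}"] by (simp add: mat_op_def norm_mult)
      also have "\<dots> \<le> (\<Sum>k<n. \<bar>A m k\<bar> * ip_norm (coord_space n) x)"
        unfolding ip_norm_coord_space
        by (intro sum_mono mult_left_mono member_le_L2_set) auto
      finally show "cmod (mat_op n A x m) \<le> (\<Sum>k<n. \<bar>A m k\<bar> * ip_norm (coord_space n) x)" .
    qed
    finally show ?thesis
      by (simp add: sum_distrib_right)
  qed
  then show ?thesis
    unfolding bounded_operator_def
    by (intro conjI exI[of _ "\<Sum>m<n. \<Sum>k<n. \<bar>A m k\<bar>"])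
      (auto simp: mat_op_def fun_eq_iff algebra_simps sum.distrib sum_distrib_left)
qed

text \<open>Splitting \<open>x\<close> into real and imaginary parts, the mixed terms cancel by
  symmetry; what remains is the real quadratic form at each of the two parts.\<close>

lemma positive_operator_mat_op:
  assumes sym: "\<And>m k. m < n \<Longrightarrow> k < n \<Longrightarrow> A m k = A k m"
    and psd: "\<And>y. 0 \<le> (\<Sum>m<n. \<Sum>k<n. A m k * y m * y k)"
  shows "positive_operator (coord_space n) (mat_op n A)"
proof -
  have "ip (coord_space n) x (mat_op n A x) \<in> \<real> \<and> 0 \<le> Re (ip (coord_space n) x (mat_op n A x))" for x
  proof -
    have ip: "ip (coord_space n) x (mat_op n A x) = (\<Sum>m<n. \<Sum>k<n. A m k * (cnj (x m) * x k))"
      by (simp add: mat_op_def sum_distrib_left mult_ac)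
    have "(\<Sum>m<n. \<Sum>k<n. A m k * (Im (x m) * Re (x k)))
        = (\<Sum>m<n. \<Sum>k<n. A m k * (Re (x m) * Im (x k)))"
      by (subst sum.swap) (intro sum.cong refl, simp add: sym mult_ac)
    then have "Im (ip (coord_space n) x (mat_op n A x)) = 0"
      unfolding ip by (simp add: algebra_simps sum_subtractf)
    moreover have "Re (ip (coord_space n) x (mat_op n A x))
        = (\<Sum>m<n. \<Sum>k<n. A m k * Re (x m) * Re (x k)) + (\<Sum>m<n. \<Sum>k<n. A m k * Im (x m) * Im (x k))"
      unfolding ip by (simp add: algebra_simps sum.distrib)
    ultimately show ?thesis
      using psd[of "\<lambda>k. Re (x k)"] psd[of "\<lambda>k. Im (x k)"] by (simp add: complex_is_Real_iff)
  qed
  then show ?thesis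
    unfolding positive_operator_def using bounded_operator_mat_op by blast
qed

lemma finsum_mat_op:
  assumes "finite V"
  shows "(\<Oplus>\<^bsub>coord_space n\<^esub>l\<in>V. mat_op n (A l) x) = mat_op n (\<lambda>m k. \<Sum>l\<in>V. A l m k) x"
proof -
  have "(\<Sum>l\<in>V. mat_op n (A l) x m) = mat_op n (\<lambda>m k. \<Sum>l\<in>V. A l m k) x m" for m
    by (simp add: mat_op_def sum_distrib_right) (intro impI sum.swap)
  then show ?thesis
    using finsum_coord_space[OF assms mat_op_carrier, of n A "\<lambda>_. x"] by simp
qed

lemma mat_op_identity:
  assumes "\<And>m k. m < n \<Longrightarrow> k < n \<Longrightarrow> A m k = of_bool (m = k)" "x \<in> carrier (coord_space n)"
  shows "mat_op n A x = x"
proof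
  fix m
  have "(\<Sum>k<n. A m k * x k) = (\<Sum>k<n. if k = m then x k else 0)" if "m < n"
    using assms(1) that by (intro sum.cong) auto
  then show "mat_op n A x m = x m"
    using assms(2) by (simp add: mat_op_def)
qed

lemma sum_UNIV_bool: "(\<Sum>a\<in>UNIV. f a) = f False + f True"
  by (simp add: UNIV_bool)

text \<open>A vector in \<open>coord_space 4\<close> is read as a two by two matrix whose entry in row \<open>a\<close> and
  column \<open>b\<close> has index \<open>2 * a + b\<close>. The next two matrices describe left multiplication by \<open>u\<close> and
  right multiplication by the transpose of \<open>u\<close>.\<close>

definition left_mult :: "(nat \<Rightarrow> nat \<Rightarrow> real) \<Rightarrow> nat \<Rightarrow> nat \<Rightarrow> real" where
  "left_mult u m k = of_bool (m mod 2 = k mod 2) * u (m div 2) (k div 2)"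

definition right_mult :: "(nat \<Rightarrow> nat \<Rightarrow> real) \<Rightarrow> nat \<Rightarrow> nat \<Rightarrow> real" where
  "right_mult u m k = of_bool (m div 2 = k div 2) * u (m mod 2) (k mod 2)"

text \<open>The identity matrix, normalized in the Hilbert-Schmidt norm: the indices 0 and 3 are its
  diagonal positions.\<close>

definition max_entangled :: "nat \<Rightarrow> complex" where
  "max_entangled k = (if k = 0 \<or> k = 3 then 1 / sqrt 2 else 0)"

lemma lessThan_2_4: "{..<2::nat} = {0, 1}" "{..<4::nat} = {0, 1, 2, 3}"
  by auto

lemma max_entangled_carrier: "max_entangled \<in> carrier (coord_space 4)"
  by (simp add: max_entangled_def)

lemma max_entangled_norm: "ip_norm (coord_space 4) max_entangled = 1"
  by (simp add: ip_norm_coord_space L2_set_def lessThan_2_4 max_entangled_def power2_eq_square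
      norm_divide)

text \<open>Associativity of the matrix product, checked coordinate by coordinate.\<close>

lemma left_right_mult_commute:
  "mat_op 4 (left_mult u) (mat_op 4 (right_mult w) x)
    = mat_op 4 (right_mult w) (mat_op 4 (left_mult u) x)"
proof
  fix m :: nat
  consider "m = 0" | "m = 1" | "m = 2" | "m = 3" | "m \<ge> 4"
    by linarith
  then show "mat_op 4 (left_mult u) (mat_op 4 (right_mult w) x) m
      = mat_op 4 (right_mult w) (mat_op 4 (left_mult u) x) m"
    by cases (simp_all add: mat_op_def lessThan_2_4 left_mult_def right_mult_def algebra_simps)
qed

text \<open>The right side is the normalized trace of \<open>u\<close> times the transpose of
  \<open>w\<close>.\<close>

lemma max_entangled_trace:
  "ip (coord_space 4) max_entangled (mat_op 4 (left_mult u) (mat_op 4 (right_mult w) max_entangled))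
    = complex_of_real ((\<Sum>m<2. \<Sum>k<2. u m k * w m k) / 2)"
proof -
  have sq: "sqrt 2 * (sqrt 2 * z) = 2 * z" for z
    by (simp flip: mult.assoc)
  then show ?thesis
    by (simp add: mat_op_def lessThan_2_4 left_mult_def right_mult_def max_entangled_def
        field_simps sq flip: of_real_mult of_real_add) (simp add: complex_eq_iff)
qed

text \<open>Left multiplication acts on the two columns separately (indices 0, 2 and 1, 3), right
  multiplication on the two rows (0, 1 and 2, 3). Either form is thus a sum of two copies of the
  form of \<open>u\<close>.\<close>

lemma positive_mult_ops:
  assumes sym: "\<And>m k. u m k = u k m"
    and psd: "\<And>y. 0 \<le> (\<Sum>m<2. \<Sum>k<2. u m k * y m * y k)"
  shows "positive_operator (coord_space 4) (mat_op 4 (left_mult u))"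
    and "positive_operator (coord_space 4) (mat_op 4 (right_mult u))"
proof -
  have *: "0 \<le> u 0 0 * a * a + u 0 1 * a * b + (u 1 0 * b * a + u 1 1 * b * b)" for a b
    using psd[of "\<lambda>k. if k = 0 then a else b"] by (simp add: lessThan_2_4)
  show "positive_operator (coord_space 4) (mat_op 4 (left_mult u))"
  proof (rule positive_operator_mat_op)
    show "0 \<le> (\<Sum>m<4. \<Sum>k<4. left_mult u m k * y m * y k)" for y
      using add_mono[OF *[of "y 0" "y 2"] *[of "y 1" "y 3"]]
      by (simp add: lessThan_2_4 left_mult_def add_ac)
  qed (use sym in \<open>auto simp: left_mult_def\<close>)
  show "positive_operator (coord_space 4) (mat_op 4 (right_mult u))"
  proof (rule positive_operator_mat_op)
    show "0 \<le> (\<Sum>m<4. \<Sum>k<4. right_mult u m k * y m * y k)" for y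
      using add_mono[OF *[of "y 0" "y 1"] *[of "y 2" "y 3"]]
      by (simp add: lessThan_2_4 right_mult_def add_ac)
  qed (use sym in \<open>auto simp: right_mult_def\<close>)
qed


section \<open>Three measurements at pairwise angles of 60 degrees\<close>

text \<open>For each \<open>s\<close> below 3, an orthonormal basis of the real plane. The vectors
  for outcome \<open>True\<close> have angles 0, 60 and -60 degrees, so their lines meet pairwise at
  60 degrees.\<close>

definition trine :: "nat \<Rightarrow> bool \<Rightarrow> nat \<Rightarrow> real" where
  "trine s a m =
    (if s = 0 then of_bool (if a then m = 0 else m = 1)
     else if a then (if m = 0 then 1 / 2 else if s = 1 then sqrt 3 / 2 else - sqrt 3 / 2)
     else (if m = 0 then sqrt 3 / 2 else if s = 1 then - 1 / 2 else 1 / 2))"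

text \<open>The normalized trace of the product of two rank-one projections is half the squared
  inner product of their unit vectors.\<close>

definition trine_prob :: "nat \<Rightarrow> nat \<Rightarrow> bool \<Rightarrow> bool \<Rightarrow> real" where
  "trine_prob s t a b = (\<Sum>m<2. trine s a m * trine t b m)\<^sup>2 / 2"

lemma trine_complete:
  assumes "m < 2" "k < 2"
  shows "(\<Sum>a\<in>UNIV. trine s a m * trine s a k) = of_bool (m = k)"
proof -
  have "m = 0 \<or> m = 1" "k = 0 \<or> k = 1"
    using assms by auto
  then show ?thesis
    by (auto simp: UNIV_bool trine_def)
qed

text \<open>For \<open>s\<close> and \<open>t\<close> distinct, the lines are at 60 degrees for
  equal outcomes and at 30 degrees for different ones, with squared cosines 1/4 and 3/4.\<close>

lemma trine_prob_eq:
  assumes "s < 3" "t < 3"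
  shows "trine_prob s t a b =
    (if s = t then (if a = b then 1 / 2 else 0) else (if a = b then 1 / 8 else 3 / 8))"
proof -
  have "s = 0 \<or> s = 1 \<or> s = 2" "t = 0 \<or> t = 1 \<or> t = 2"
    using assms by auto
  then show ?thesis
    by (cases a; cases b)
      (auto simp: trine_prob_def trine_def lessThan_2_4 power2_eq_square field_simps)
qed


section \<open>The correlation of three disjoint automorphisms\<close>

text \<open>\<open>c i\<close> is meant to be an index for which every automorphism \<open>S t\<close> with \<open>t \<noteq> c i\<close> fixes
  \<open>i\<close>; the outcome \<open>True\<close> of a measurement leaves the vertex where it is. The entries of the magic
  unitary are \<open>trine_magic S c i l\<close>.\<close>

definition move :: "(nat \<Rightarrow> 'v \<Rightarrow> 'v) \<Rightarrow> ('v \<Rightarrow> nat) \<Rightarrow> 'v \<Rightarrow> bool \<Rightarrow> 'v" where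
  "move S c i a = (if a then i else S (c i) i)"

text \<open>The sum runs over outcomes because a vertex fixed by \<open>S (c i)\<close> has the same
  image under both, and their probabilities then add up.\<close>

definition trine_corr :: "(nat \<Rightarrow> 'v \<Rightarrow> 'v) \<Rightarrow> ('v \<Rightarrow> nat) \<Rightarrow> 'v corr" where
  "trine_corr S c l k i j = (\<Sum>a\<in>UNIV. \<Sum>b\<in>UNIV.
     of_bool (l = move S c i a) * of_bool (k = move S c j b) * trine_prob (c i) (c j) a b)"

definition trine_magic :: "(nat \<Rightarrow> 'v \<Rightarrow> 'v) \<Rightarrow> ('v \<Rightarrow> nat) \<Rightarrow> 'v \<Rightarrow> 'v \<Rightarrow> nat \<Rightarrow> nat \<Rightarrow> real" where
  "trine_magic S c i l m k =
    (\<Sum>a\<in>UNIV. of_bool (l = move S c i a) * (trine (c i) a m * trine (c i) a k))"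

lemma trine_magic_positive:
  "positive_operator (coord_space 4) (mat_op 4 (left_mult (trine_magic S c i l)))"
  "positive_operator (coord_space 4) (mat_op 4 (right_mult (trine_magic S c i l)))"
proof -
  have sym: "trine_magic S c i l m k = trine_magic S c i l k m" for m k
    by (simp add: trine_magic_def mult_ac)
  have psd: "0 \<le> (\<Sum>m<2. \<Sum>k<2. trine_magic S c i l m k * y m * y k)" for y
  proof -
    \<comment> \<open>Each outcome contributes a rank-one projection, whose quadratic form is a
      square.\<close>
    have "(\<Sum>m<2. \<Sum>k<2. trine_magic S c i l m k * y m * y k)
        = (\<Sum>a\<in>UNIV. of_bool (l = move S c i a) * (\<Sum>m<2. trine (c i) a m * y m)\<^sup>2)"
      by (simp add: trine_magic_def lessThan_2_4 UNIV_bool power2_eq_square algebra_simps)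
    also have "\<dots> \<ge> 0"
      by (intro sum_nonneg) auto
    finally show ?thesis .
  qed
  show "positive_operator (coord_space 4) (mat_op 4 (left_mult (trine_magic S c i l)))"
    "positive_operator (coord_space 4) (mat_op 4 (right_mult (trine_magic S c i l)))"
    using positive_mult_ops[OF sym psd] by blast+
qed

text \<open>Each outcome \<open>a\<close> contributes to exactly one \<open>l\<close> in
  \<open>V\<close>, so summing over \<open>l\<close> leaves the two projections of an orthonormal
  basis.\<close>

lemma trine_magic_row_sum:
  assumes "finite V" "\<And>a. move S c i a \<in> V" "m < 2" "k < 2"
  shows "(\<Sum>l\<in>V. trine_magic S c i l m k) = of_bool (m = k)"
proof -
  have "(\<Sum>l\<in>V. trine_magic S c i l m k)
      = (\<Sum>a\<in>UNIV. \<Sum>l\<in>V. of_bool (l = move S c i a) * (trine (c i) a m * trine (c i) a k))"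
    unfolding trine_magic_def by (rule sum.swap)
  also have "\<dots> = (\<Sum>a\<in>UNIV. trine (c i) a m * trine (c i) a k)"
    using assms(1,2) by (intro sum.cong refl) (simp add: of_bool_def if_distrib if_distribR cong: if_cong)
  also have "\<dots> = of_bool (m = k)"
    using assms(3,4) by (rule trine_complete)
  finally show ?thesis .
qed

lemma trine_corr_realization:
  assumes V: "finite V" and move: "\<And>i a. i \<in> V \<Longrightarrow> move S c i a \<in> V"
  shows "quantum_realization (coord_space 4) max_entangled
    (\<lambda>i l. mat_op 4 (left_mult (trine_magic S c i l)))
    (\<lambda>i l. mat_op 4 (right_mult (trine_magic S c i l))) V (trine_corr S c)"
proof -
  have left: "(\<Oplus>\<^bsub>coord_space 4\<^esub>l\<in>V. mat_op 4 (left_mult (trine_magic S c i l)) x) = x"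
    and right: "(\<Oplus>\<^bsub>coord_space 4\<^esub>l\<in>V. mat_op 4 (right_mult (trine_magic S c i l)) x) = x"
    if i: "i \<in> V" and x: "x \<in> carrier (coord_space 4)" for i x
  proof -
    note rows = trine_magic_row_sum[OF V move[OF i]]
    \<comment> \<open>The Kronecker delta on the four indices factors into one for rows and one for
      columns.\<close>
    have split: "m = k \<longleftrightarrow> m div 2 = k div 2 \<and> m mod 2 = k mod 2" for m k :: nat
      by (metis div_mult_mod_eq)
    show "(\<Oplus>\<^bsub>coord_space 4\<^esub>l\<in>V. mat_op 4 (left_mult (trine_magic S c i l)) x) = x"
      unfolding finsum_mat_op[OF V]
    proof (rule mat_op_identity[OF _ x])
      show "(\<Sum>l\<in>V. left_mult (trine_magic S c i l) m k) = of_bool (m = k)" if "m < 4" "k < 4" for m k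
        using rows[of "m div 2" "k div 2"] less_mult_imp_div_less[of _ 2 2] that
        by (auto simp: left_mult_def split[of m k] simp flip: sum_distrib_left)
    qed
    show "(\<Oplus>\<^bsub>coord_space 4\<^esub>l\<in>V. mat_op 4 (right_mult (trine_magic S c i l)) x) = x"
      unfolding finsum_mat_op[OF V]
    proof (rule mat_op_identity[OF _ x])
      show "(\<Sum>l\<in>V. right_mult (trine_magic S c i l) m k) = of_bool (m = k)" for m k
        using rows[of "m mod 2" "k mod 2"]
        by (auto simp: right_mult_def split[of m k] simp flip: sum_distrib_left)
    qed
  qed
  have corr: "trine_corr S c l k i j
      = (\<Sum>m<2. \<Sum>n<2. trine_magic S c i l m n * trine_magic S c j k m n) / 2" for l k i j
    by (simp add: trine_corr_def trine_magic_def trine_prob_def UNIV_bool lessThan_2_4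
        power2_eq_square field_simps)
  show ?thesis
    unfolding quantum_realization_def max_entangled_trace corr
    by (intro conjI ballI complex_hilbert_space_coord_space max_entangled_carrier
        max_entangled_norm trine_magic_positive left right left_right_mult_commute refl)
qed

lemma trine_corr_correlation:
  assumes V: "finite V" and move: "\<And>i a. i \<in> V \<Longrightarrow> move S c i a \<in> V"
    and c: "\<And>i. c i < 3"
  shows "correlation V (trine_corr S c)"
proof -
  have total: "(\<Sum>a\<in>UNIV. \<Sum>b\<in>UNIV. trine_prob (c i) (c j) a b) = 1" for i j
    using c by (simp add: UNIV_bool trine_prob_eq)
  have nonneg: "0 \<le> trine_corr S c l k i j" for l k i j
    unfolding trine_corr_def by (intro sum_nonneg) (simp add: trine_prob_def)
  \<comment> \<open>Replacing both indicators by 1 can only enlarge the sum, and turns it into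
    \<open>total\<close>.\<close>
  have le_1: "trine_corr S c l k i j \<le> 1" for l k i j
    unfolding total[of i j, symmetric] trine_corr_def
    by (intro sum_mono) (auto simp: trine_prob_def)
  have "(\<Sum>l\<in>V. \<Sum>k\<in>V. trine_corr S c l k i j) = 1" if "i \<in> V" "j \<in> V" for i j
  proof -
    have delta: "(\<Sum>l\<in>V. of_bool (l = move S c i a)) = (1::real)" if "i \<in> V" for i a
      using V move[OF that] by (simp add: of_bool_def)
    have "(\<Sum>l\<in>V. \<Sum>k\<in>V. of_bool (l = move S c i a) * of_bool (k = move S c j b) * z) = z"
      for a b and z :: real
    proof -
      have "(\<Sum>l\<in>V. \<Sum>k\<in>V. of_bool (l = move S c i a) * of_bool (k = move S c j b) * z)
          = (\<Sum>l\<in>V. of_bool (l = move S c i a)) * (\<Sum>k\<in>V. of_bool (k = move S c j b)) * z"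
        by (subst sum_product) (simp only: sum_distrib_right)
      then show ?thesis
        using that by (simp only: delta mult_1_left)
    qed
    then show ?thesis
      using total[of i j] by (simp only: trine_corr_def sum_UNIV_bool sum.distrib)
  qed
  then show ?thesis
    unfolding correlation_def using nonneg le_1 by simp
qed

section \<open>The winning condition\<close>

lemma graph_aut_rel:
  assumes "\<pi> \<in> graph_aut G" "i \<in> pverts G" "j \<in> pverts G"
  shows "rel G (\<pi> i) (\<pi> j) = rel G i j"
proof -
  have "inj \<pi>" "(\<pi> i, \<pi> j) \<in> parcs G \<longleftrightarrow> (i, j) \<in> parcs G"
    using assms by (auto simp: graph_aut_def intro: permutes_inj)
  then show ?thesis
    by (simp add: rel_def inj_eq)
qed

lemma trine_corr_winning:
  assumes aut: "\<And>s. s < 3 \<Longrightarrow> S s \<in> graph_aut G"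
    and disj: "\<And>s t i. \<lbrakk>s < 3; t < 3; s \<noteq> t; i \<in> pverts G; S s i \<noteq> i\<rbrakk> \<Longrightarrow> S t i = i"
    and c: "\<And>i. c i < 3"
    and fix_other: "\<And>i t. \<lbrakk>i \<in> pverts G; t < 3; t \<noteq> c i\<rbrakk> \<Longrightarrow> S t i = i"
  shows "winning G (trine_corr S c)"
proof -
  have in_V: "S s i \<in> pverts G" if "s < 3" "i \<in> pverts G" for s i
    using aut[OF that(1)] that(2) by (simp add: graph_aut_def permutes_in_image)
  \<comment> \<open>Different outcomes of the same measurement have probability 0, so
    \<open>a = b\<close> may be assumed when \<open>c i = c j\<close>. A single automorphism, or the
    identity, then acts on both vertices.\<close>
  have rel: "rel G (move S c i a) (move S c j b) = rel G i j"
    if i: "i \<in> pverts G" and j: "j \<in> pverts G" and ab: "c i = c j \<Longrightarrow> a = b" for i j a b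
  proof (cases "c i = c j")
    case True
    then show ?thesis
      using ab graph_aut_rel[OF aut[OF c] i j, of j] by (simp add: move_def)
  next
    case False
    have ij: "S (c i) j = j" and ji: "S (c j) i = i"
      using False fix_other c i j by metis+
    have one: "rel G (S (c i) i) j = rel G i j"
      using graph_aut_rel[OF aut[OF c] i j, of i] ij by simp
    have two: "rel G i (S (c j) j) = rel G i j"
      using graph_aut_rel[OF aut[OF c] i j, of j] ji by simp
    \<comment> \<open>If \<open>S (c i)\<close> moves \<open>i\<close>, then by injectivity it also
      moves the image of \<open>i\<close>, which disjointness makes a fixed point of
      \<open>S (c j)\<close>.\<close>
    have "S (c j) (S (c i) i) = S (c i) i"
    proof (cases "S (c i) i = i")
      case False
      then have "S (c i) (S (c i) i) \<noteq> S (c i) i"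
        using aut[OF c[of i]] by (metis (no_types, lifting) graph_aut_def inj_eq mem_Collect_eq permutes_inj)
      then show ?thesis
        using disj[OF c c \<open>c i \<noteq> c j\<close> in_V[OF c i]] by blast
    qed (simp add: ji)
    \<comment> \<open>\<open>S (c j)\<close> is applied to the pair \<open>S (c i) i\<close>,
      \<open>j\<close>, whose first entry it fixes.\<close>
    then have both: "rel G (S (c i) i) (S (c j) j) = rel G i j"
      using graph_aut_rel[OF aut[OF c] in_V[OF c i] j, of j i] one by simp
    show ?thesis
      using one two both by (simp add: move_def)
  qed
  have "trine_corr S c l k i j = 0"
    if "i \<in> pverts G" "j \<in> pverts G" "rel G i j \<noteq> rel G l k" for i j l k
  proof -
    have "of_bool (l = move S c i a) * of_bool (k = move S c j b) * trine_prob (c i) (c j) a b = 0"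
      for a b
      using rel[OF that(1,2), of a b] that(3) by (auto simp: trine_prob_eq[OF c c])
    then show ?thesis
      unfolding trine_corr_def by (intro sum.neutral ballI)
  qed
  then show ?thesis
    unfolding winning_def by blast
qed

section \<open>The bound for classical correlations\<close>

lemma trine_corr_not_classical:
  assumes i: "\<And>s. s < 3 \<Longrightarrow> i s \<in> pverts G" "\<And>s. s < 3 \<Longrightarrow> S s (i s) \<in> pverts G"
    and moved: "\<And>s. s < 3 \<Longrightarrow> S s (i s) \<noteq> i s"
    and c: "\<And>s. s < 3 \<Longrightarrow> c (i s) = s"
  shows "\<not> winning_classical G (trine_corr S c)"
proof
  \<comment> \<open>The probability that exactly one of \<open>i s\<close>, \<open>i t\<close> stays
    in place while the other goes to its image under its own automorphism.\<close>
  define D :: "'a corr \<Rightarrow> nat \<Rightarrow> nat \<Rightarrow> real" where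
    "D p s t = p (i s) (S t (i t)) (i s) (i t) + p (S s (i s)) (i t) (i s) (i t)" for p s t
  assume "winning_classical G (trine_corr S c)"
  then obtain w where w: "\<And>\<pi>. \<pi> \<in> graph_aut G \<Longrightarrow> 0 \<le> w \<pi>" "(\<Sum>\<pi>\<in>graph_aut G. w \<pi>) = 1"
    and p: "\<And>i j l k. \<lbrakk>i \<in> pverts G; j \<in> pverts G; l \<in> pverts G; k \<in> pverts G\<rbrakk>
      \<Longrightarrow> trine_corr S c l k i j = (\<Sum>\<pi>\<in>graph_aut G. w \<pi> * det_corr \<pi> l k i j)"
    unfolding winning_classical_def by blast
  have mixture: "D (trine_corr S c) s t = (\<Sum>\<pi>\<in>graph_aut G. w \<pi> * D (det_corr \<pi>) s t)"
    if "s < 3" "t < 3" for s t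
    using i that by (simp add: D_def p distrib_left sum.distrib)
  \<comment> \<open>Two pairs of unequal outcomes, each of probability 3/8.\<close>
  have "D (trine_corr S c) s t = 3 / 4" if "s < 3" "t < 3" "s \<noteq> t" for s t
    using that moved[of s] moved[of t]
    by (auto simp: D_def trine_corr_def move_def UNIV_bool c trine_prob_eq)
  then have "9 / 4 = D (trine_corr S c) 0 1 + D (trine_corr S c) 1 2 + D (trine_corr S c) 0 2"
    by simp
  also have "\<dots> = (\<Sum>\<pi>\<in>graph_aut G. w \<pi> * (D (det_corr \<pi>) 0 1 + D (det_corr \<pi>) 1 2 + D (det_corr \<pi>) 0 2))"
    by (simp add: mixture distrib_left sum.distrib)
  \<comment> \<open>For a single \<open>\<pi>\<close> each \<open>D\<close> is 0 or 1. If all three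
    were 1, then \<open>\<pi>\<close> would fix or move each of the three vertices in such a way
    that every two of these choices differ.\<close>
  also have "\<dots> \<le> (\<Sum>\<pi>\<in>graph_aut G. w \<pi> * 2)"
    using moved[of 0] moved[of 1] moved[of 2] w(1)
    by (intro sum_mono mult_left_mono) (auto simp: D_def det_corr_def)
  also have "\<dots> = 2"
    using w(2) by (simp flip: sum_distrib_right)
  finally show False
    by simp
qed

theorem theorem4p10:
  fixes G :: "'v pair_pre_digraph" and \<sigma>1 \<sigma>2 \<sigma>3 :: "'v \<Rightarrow> 'v"
  assumes "pair_graph G"
    and "\<sigma>1 \<in> graph_aut G" and "\<sigma>2 \<in> graph_aut G" and "\<sigma>3 \<in> graph_aut G"
    and "\<sigma>1 \<noteq> id" and "\<sigma>2 \<noteq> id" and "\<sigma>3 \<noteq> id"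
    and "disjoint_perms (pverts G) [\<sigma>1, \<sigma>2, \<sigma>3]"
  shows "nonlocal_symmetry G"
proof -
  define S where "S s = [\<sigma>1, \<sigma>2, \<sigma>3] ! s" for s
  \<comment> \<open>The value 2 also covers vertices that all three automorphisms fix, where any
    index would do.\<close>
  define c :: "'v \<Rightarrow> nat" where "c i = (if S 0 i \<noteq> i then 0 else if S 1 i \<noteq> i then 1 else 2)" for i
  have cases3: "s = 0 \<or> s = 1 \<or> s = 2" if "s < 3" for s :: nat
    using that by auto
  have finite: "finite (pverts G)"
  proof -
    interpret pair_graph G
      by (rule assms(1))
    show ?thesis
      by (rule pair_finite_verts)
  qed
  have aut: "S s \<in> graph_aut G" if "s < 3" for s
    using cases3[OF that] assms by (auto simp: S_def)
  have nontriv: "S s \<noteq> id" if "s < 3" for s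
    using cases3[OF that] assms by (auto simp: S_def)
  have disj: "S t i = i" if "s < 3" "t < 3" "s \<noteq> t" "i \<in> pverts G" "S s i \<noteq> i" for s t i
    using assms(8) that by (auto simp: disjoint_perms_def S_def numeral_3_eq_3)
  have c: "c i < 3" for i
    by (simp add: c_def)
  have fix_other: "S t i = i" if "i \<in> pverts G" "t < 3" "t \<noteq> c i" for i t
    using cases3[OF that(2)] that disj[of 0 t i] disj[of 1 t i] by (auto simp: c_def split: if_splits)
  have in_V: "S s i \<in> pverts G" if "s < 3" "i \<in> pverts G" for s i
    using aut[OF that(1)] that(2) by (simp add: graph_aut_def permutes_in_image)
  then have move: "move S c i a \<in> pverts G" if "i \<in> pverts G" for i a
    using c that by (simp add: move_def)
  \<comment> \<open>An automorphism is the identity outside the vertex set, so a nontrivial one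
    moves a vertex.\<close>
  have "\<exists>i. i \<in> pverts G \<and> S s i \<noteq> i" if "s < 3" for s
    using aut[OF that] nontriv[OF that] by (auto simp: graph_aut_def permutes_def fun_eq_iff)
  then obtain i where i: "\<And>s. s < 3 \<Longrightarrow> i s \<in> pverts G" "\<And>s. s < 3 \<Longrightarrow> S s (i s) \<noteq> i s"
    by metis
  \<comment> \<open>Otherwise \<open>fix_other\<close> would make \<open>i s\<close> a fixed point
    of \<open>S s\<close>.\<close>
  have "c (i s) = s" if "s < 3" for s
    using fix_other i that by metis
  then have "\<not> winning_classical G (trine_corr S c)"
    using i in_V by (intro trine_corr_not_classical) auto
  moreover have "winning G (trine_corr S c)"
    using aut disj c fix_other by (rule trine_corr_winning)
  moreover have "quantum_correlation (pverts G) (trine_corr S c)"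
    unfolding quantum_correlation_def
    using trine_corr_correlation[OF finite move c] trine_corr_realization[OF finite move] by blast
  ultimately show ?thesis
    unfolding nonlocal_symmetry_def by blast
qed

end
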